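(* Let $K:X\to Y$ be a linear compact operator with a singular system denoted by $\{(\sigma_n,v_n,u_n)\}_{n\in\mathbb{N}}$. For every $\alpha>0$ and $0<\sigma_n\le\|K\|$, suppose there exists $c(\alpha)$ such that $c(\alpha)\sigma_n\ge1$, where $\sigma_n$ satisfies $|\sigma_n\langle y^\delta,u_n\rangle|>\frac{\alpha}{2}$. For $\alpha>0$ let $$\mathcal{R}_\alpha y^\delta:=\sum_{n\in\mathbb{N}}\frac{1}{\sigma_n^2}\,\mathcal{S}_\alpha\big(\sigma_n\langle y^\delta,u_n\rangle\big)v_n,\qquad y^\delta\in Y.$$ (1) Suppose there exists a constant $c_1$ such that $c_1\ge\sigma_n/\sqrt{\alpha}>0$ for all $\alpha>0$ and $0<\sigma_n\le\|K\|$. If $x\in\mathcal{R}(K^* )$, then $$\|\mathcal{R}_\alpha Kx-x\|\le c_1\sqrt{\alpha}\,\|z\|,$$ where $x=K^*z$. (2) Suppose there exists a constant $c_2$ such that $c_2\ge\sigma_n^2/\alpha>0$ for all $\alpha>0$ and $0<\sigma_n\le\|K\|$. If $x\in\mathcal{R}(K^*K)$, then $$\|\mathcal{R}_\alpha Kx-x\|\le c_2\,\alpha\,\|z\|,$$ where $x=K^*Kz$.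
   Context: $X$ and $Y$ are Hilbert spaces, $\langle\cdot,\cdot\rangle$ denotes the inner product in $X$ and in $Y$, and $y^\delta\in Y$ denotes (noisy) data. For $\alpha>0$, the soft thresholding function $\mathcal{S}_\alpha:\mathbb{R}\to\mathbb{R}$ is $$\mathcal{S}_\alpha(t)=\begin{cases}t+\frac{\alpha}{2},& t\le-\frac{\alpha}{2},\\ 0,& |t|\le\frac{\alpha}{2},\\ t-\frac{\alpha}{2},& t\ge\frac{\alpha}{2}.\end{cases}$$ $K^*:Y\to X$ is the adjoint of $K$, and $\mathcal{R}(K^* )$, $\mathcal{R}(K^*K)$ denote the ranges of the indicated operators (not to be confused with $\mathcal{R}_\alpha$). A singular system $\{(\sigma_n,v_n,u_n)\}_{n\in\mathbb{N}}$ of $K$ consists of the positive singular values $\sigma_n$ of $K$ (the square roots of the eigenvalues of $K^*K$), in decreasing order and counted with multiplicity, together with corresponding complete orthonormal systems $\{v_n\}\subset X$ and $\{u_n\}\subset Y$ of eigenvectors of $K^*K$ and $KK^*$ respectively, with $Kv_n=\sigma_nu_n$ and $K^*u_n=\sigma_nv_n$; every $x\in X$ and $y\in Y$ is expressed as $x=\sum_n\langle x,v_n\rangle v_n$ and $y=\sum_n\langle y,u_n\rangle u_n$. *)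

theory Defs
  imports "HOL-Analysis.Analysis"
begin

text \<open>
  Hilbert spaces are types of sort \<open>{real_inner, complete_space}\<close>; the scalars are real because
  the soft thresholding function acts on the coefficients \<open>\<sigma>\<^sub>n \<langle>y, u\<^sub>n\<rangle>\<close> as real numbers.
\<close>

definition compact_operator ::
  "('a::{real_inner,complete_space} \<Rightarrow> 'b::{real_inner,complete_space}) \<Rightarrow> bool" where
  "compact_operator K \<longleftrightarrow> linear K \<and> (\<forall>B. bounded B \<longrightarrow> compact (closure (K ` B)))"

definition singular_values ::
  "('a::{real_inner,complete_space} \<Rightarrow> 'b::{real_inner,complete_space}) \<Rightarrow> real set" where
  "singular_values K = {s. 0 < s \<and> (\<exists>x. x \<noteq> 0 \<and> adjoint K (K x) = s\<^sup>2 *\<^sub>R x)}"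

definition complete_orthonormal :: "(nat \<Rightarrow> 'a::{real_inner,complete_space}) \<Rightarrow> bool" where
  "complete_orthonormal e \<longleftrightarrow>
     (\<forall>m n. e m \<bullet> e n = (if m = n then 1 else 0)) \<and>
     (\<forall>x. (\<lambda>n. (x \<bullet> e n) *\<^sub>R e n) sums x)"

text \<open>
  The clause equating a cardinality with an eigenspace dimension says that each singular value is
  listed according to its multiplicity. For a compact \<open>K\<close> both sides are finite, so the
  convention that infinite cardinalities and dimensions are \<open>0\<close> plays no role.
\<close>

definition singular_system ::
  "('a::{real_inner,complete_space} \<Rightarrow> 'b::{real_inner,complete_space}) \<Rightarrow>
   (nat \<Rightarrow> real) \<Rightarrow> (nat \<Rightarrow> 'a) \<Rightarrow> (nat \<Rightarrow> 'b) \<Rightarrow> bool" where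
  "singular_system K \<sigma> v u \<longleftrightarrow>
     range \<sigma> = singular_values K \<and>
     decseq \<sigma> \<and>
     (\<forall>n. card {m. \<sigma> m = \<sigma> n} = dim {x. adjoint K (K x) = (\<sigma> n)\<^sup>2 *\<^sub>R x}) \<and>
     complete_orthonormal v \<and>
     complete_orthonormal u \<and>
     (\<forall>n. adjoint K (K (v n)) = (\<sigma> n)\<^sup>2 *\<^sub>R v n) \<and>
     (\<forall>n. K (adjoint K (u n)) = (\<sigma> n)\<^sup>2 *\<^sub>R u n) \<and>
     (\<forall>n. K (v n) = \<sigma> n *\<^sub>R u n) \<and>
     (\<forall>n. adjoint K (u n) = \<sigma> n *\<^sub>R v n)"

definition soft_threshold :: "real \<Rightarrow> real \<Rightarrow> real" where
  "soft_threshold \<alpha> t =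
     (if t \<le> - (\<alpha> / 2) then t + \<alpha> / 2
      else if \<bar>t\<bar> \<le> \<alpha> / 2 then 0
      else t - \<alpha> / 2)"

text \<open>
  For the singular system of a compact operator and \<open>\<alpha> > 0\<close>, the numbers \<open>\<sigma>\<^sub>n \<langle>y, u\<^sub>n\<rangle>\<close> tend
  to \<open>0\<close>, so only finitely many terms of the series below are nonzero and it always converges.
\<close>

definition soft_regularization ::
  "(nat \<Rightarrow> real) \<Rightarrow> (nat \<Rightarrow> 'a::{real_inner,complete_space}) \<Rightarrow>
   (nat \<Rightarrow> 'b::{real_inner,complete_space}) \<Rightarrow> real \<Rightarrow> 'b \<Rightarrow> 'a" where
  "soft_regularization \<sigma> v u \<alpha> y =
     (\<Sum>n. (1 / (\<sigma> n)\<^sup>2 * soft_threshold \<alpha> (\<sigma> n * (y \<bullet> u n))) *\<^sub>R v n)"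

text \<open>
  In the theorem, the bounds \<open>\<sigma>\<^sub>n / \<surd>\<alpha> \<le> c\<^sub>1\<close> and \<open>\<sigma>\<^sub>n\<^sup>2 / \<alpha> \<le> c\<^sub>2\<close> are stated relative to a set
  \<open>A\<close> of regularization parameters, over which the constants are uniform. Since \<open>\<sigma>\<^sub>n > 0\<close>, no
  constant can serve all \<open>\<alpha> > 0\<close> simultaneously; \<open>A = {0<..}\<close> gives that reading and
  \<open>A = {\<alpha>}\<close> the one for a single fixed parameter.
\<close>

end

theory Submission
  imports Defs
begin

text \<open>
  In the coordinates of the singular system everything is diagonal. Write \<open>x\<^sub>n = x \<bullet> v n\<close>. Since
  \<open>K x \<bullet> u n = \<sigma> n x\<^sub>n\<close>, the \<open>n\<close>-th coordinate of the regularized solution is \<open>S(\<sigma>\<^sub>n\<^sup>2 x\<^sub>n) / \<sigma>\<^sub>n\<^sup>2\<close>.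
  Thresholding moves a number towards \<open>0\<close> without crossing it, so both this coordinate and its
  distance to \<open>x\<^sub>n\<close> are at most \<open>\<bar>x\<^sub>n\<bar>\<close>. The first bound makes the series converge (it is dominated
  by a square-summable one); the second says that the error has coordinates no larger than those of
  \<open>x\<close> itself. The source conditions finish the argument: if \<open>x = K\<^sup>* z\<close> then \<open>x\<^sub>n = \<sigma>\<^sub>n (z \<bullet> u n)\<close>, if
  \<open>x = K\<^sup>* K z\<close> then \<open>x\<^sub>n = \<sigma>\<^sub>n\<^sup>2 (z \<bullet> v n)\<close>, and the assumed bounds on \<open>\<sigma>\<^sub>n\<close> and \<open>\<sigma>\<^sub>n\<^sup>2\<close>, combined with
  Parseval's identity, turn this into the two norm estimates.

  The constant \<^const>\<open>adjoint\<close> is a choice among maps satisfying the adjoint identity, hence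
  carries information only if such a map exists. Here it is built from the orthonormal system
  of the domain (lemma \<open>adjoint_works_orthonormal\<close>).
\<close>

section \<open>Complete orthonormal systems\<close>

lemma complete_orthonormal_inner:
  "complete_orthonormal e \<Longrightarrow> e m \<bullet> e n = (if m = n then 1 else 0)"
  by (simp add: complete_orthonormal_def)

lemma complete_orthonormal_sums:
  "complete_orthonormal e \<Longrightarrow> (\<lambda>n. (x \<bullet> e n) *\<^sub>R e n) sums x"
  by (simp add: complete_orthonormal_def)

lemma complete_orthonormal_norm [simp]: "complete_orthonormal e \<Longrightarrow> norm (e n) = 1"
  by (simp add: norm_eq_sqrt_inner complete_orthonormal_inner)

lemma parseval:
  assumes "complete_orthonormal e"
  shows "(\<lambda>n. (x \<bullet> e n)\<^sup>2) sums (norm x)\<^sup>2"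
  using bounded_linear.sums[OF bounded_linear_inner_right[of x]
      complete_orthonormal_sums[OF assms, of x]]
  by (simp add: power2_norm_eq_inner flip: power2_eq_square)

lemma norm_orthonormal_sum:
  assumes "complete_orthonormal e" "finite I"
  shows "(norm (\<Sum>n\<in>I. c n *\<^sub>R e n))\<^sup>2 = (\<Sum>n\<in>I. (c n)\<^sup>2)"
proof -
  have "(norm (\<Sum>n\<in>I. c n *\<^sub>R e n))\<^sup>2 = (\<Sum>n\<in>I. norm (c n *\<^sub>R e n) ^ 2)"
    by (rule norm_sum_Pythagorean)
      (use assms in \<open>auto simp: pairwise_def orthogonal_def complete_orthonormal_inner\<close>)
  then show ?thesis
    using assms by simp
qed

text \<open>
  The Riesz--Fischer theorem: by Pythagoras the partial sums of the vector series are Cauchy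
  as soon as those of the scalar series of squares are.
\<close>

lemma riesz_fischer:
  fixes e :: "nat \<Rightarrow> 'a::{real_inner,complete_space}"
  assumes e: "complete_orthonormal e" and c: "summable (\<lambda>n. (c n)\<^sup>2)"
  shows "summable (\<lambda>n. c n *\<^sub>R e n)" and "(\<Sum>n. c n *\<^sub>R e n) \<bullet> e m = c m"
proof -
  have "Cauchy (\<lambda>n. \<Sum>k<n. c k *\<^sub>R e k)"
    unfolding Cauchy_altdef2
  proof (intro allI impI)
    fix r :: real assume "r > 0"
    then obtain N where N: "\<And>m n. m \<ge> N \<Longrightarrow> norm (\<Sum>k=m..<n. (c k)\<^sup>2) < r\<^sup>2"
      using c unfolding summable_Cauchy by (metis zero_less_power)
    have "dist (\<Sum>k<n. c k *\<^sub>R e k) (\<Sum>k<N. c k *\<^sub>R e k) < r" if "n \<ge> N" for n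
    proof -
      have "(\<Sum>k<n. c k *\<^sub>R e k) - (\<Sum>k<N. c k *\<^sub>R e k) = (\<Sum>k=N..<n. c k *\<^sub>R e k)"
        using that by (simp add: lessThan_atLeast0 sum_diff_nat_ivl)
      moreover have "(norm (\<Sum>k=N..<n. c k *\<^sub>R e k))\<^sup>2 < r\<^sup>2"
        using N[of N n] by (simp add: norm_orthonormal_sum[OF e] sum_nonneg)
      ultimately show ?thesis
        using \<open>r > 0\<close> by (simp add: dist_norm power2_less_imp_less)
    qed
    then show "\<exists>N. \<forall>n\<ge>N. dist (\<Sum>k<n. c k *\<^sub>R e k) (\<Sum>k<N. c k *\<^sub>R e k) < r"
      by blast
  qed
  then have "convergent (\<lambda>n. \<Sum>k<n. c k *\<^sub>R e k)"
    by (rule Cauchy_convergent)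
  then show s: "summable (\<lambda>n. c n *\<^sub>R e n)"
    by (simp add: summable_iff_convergent)
  have "(\<lambda>n. (c n *\<^sub>R e n) \<bullet> e m) sums ((\<Sum>n. c n *\<^sub>R e n) \<bullet> e m)"
    by (intro bounded_linear.sums[OF bounded_linear_inner_left] summable_sums s)
  moreover have "(\<lambda>n. (c n *\<^sub>R e n) \<bullet> e m) = (\<lambda>n. if n = m then c m else 0)"
    by (auto simp: complete_orthonormal_inner[OF e])
  ultimately show "(\<Sum>n. c n *\<^sub>R e n) \<bullet> e m = c m"
    using sums_unique2[OF _ sums_single[of m "\<lambda>_. c m"]] by simp
qed

text \<open>
  Domination of coordinates, even with respect to systems of different spaces, is domination of
  norms. Both source conditions use it, one with \<open>f\<close> in the codomain of \<open>K\<close> and one in its domain.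
\<close>

lemma norm_le_by_coordinates:
  assumes "complete_orthonormal e" "complete_orthonormal f" "C \<ge> 0"
    and le: "\<And>n. \<bar>w \<bullet> e n\<bar> \<le> C * \<bar>z \<bullet> f n\<bar>"
  shows "norm w \<le> C * norm z"
proof -
  have "(w \<bullet> e n)\<^sup>2 \<le> C\<^sup>2 * (z \<bullet> f n)\<^sup>2" for n
    using power_mono[OF le abs_ge_zero, of n 2] by (simp add: power_mult_distrib)
  then have "(norm w)\<^sup>2 \<le> C\<^sup>2 * (norm z)\<^sup>2"
    using sums_le[OF _ parseval[OF assms(1)] sums_mult[OF parseval[OF assms(2)]]] by blast
  then show ?thesis
    using assms(3) by (simp flip: power_mult_distrib)
qed

section \<open>Boundedness and adjoints\<close>

lemma compact_operator_bounded_linear: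
  assumes "compact_operator K"
  shows "bounded_linear K"
proof -
  have lin: "linear K" and "compact (closure (K ` cball 0 1))"
    using assms by (auto simp: compact_operator_def)
  then have "bounded (K ` cball 0 1)"
    by (meson bounded_subset closure_subset compact_imp_bounded)
  then obtain B where B: "\<And>x. norm x \<le> 1 \<Longrightarrow> norm (K x) \<le> B"
    unfolding bounded_iff by (metis image_eqI mem_cball_0)
  have "norm (K x) \<le> norm x * B" for x
  proof (cases "x = 0")
    case False
    then have "norm (K (x /\<^sub>R norm x)) \<le> B"
      by (intro B) simp
    then show ?thesis
      using False by (simp add: linear_scale[OF lin] field_simps)
  qed (simp add: linear_0[OF lin])
  then show ?thesis
    using lin by (auto simp: bounded_linear_def bounded_linear_axioms_def)
qed

text \<open>
  The adjoint has to send \<open>y\<close> to the vector with coordinates \<open>K (e n) \<bullet> y\<close>. They are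
  square-summable: for the partial sum \<open>w\<close> of the corresponding series,
  \<open>\<parallel>w\<parallel>\<^sup>2 = K w \<bullet> y \<le> \<parallel>K\<parallel> \<parallel>w\<parallel> \<parallel>y\<parallel>\<close>, so that \<open>\<parallel>w\<parallel> \<le> \<parallel>K\<parallel> \<parallel>y\<parallel>\<close> uniformly.
\<close>

lemma adjoint_works_orthonormal:
  fixes K :: "'a::{real_inner,complete_space} \<Rightarrow> 'b::{real_inner,complete_space}"
    and e :: "nat \<Rightarrow> 'a"
  assumes K: "bounded_linear K" and e: "complete_orthonormal e"
  shows "x \<bullet> adjoint K y = K x \<bullet> y"
proof -
  interpret bounded_linear K by (rule K)
  have summ: "summable (\<lambda>n. (K (e n) \<bullet> y)\<^sup>2)" for y
  proof (rule summableI_nonneg_bounded[where x = "(onorm K * norm y)\<^sup>2"])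
    fix N
    define w where "w = (\<Sum>n<N. (K (e n) \<bullet> y) *\<^sub>R e n)"
    have w: "(norm w)\<^sup>2 = (\<Sum>n<N. (K (e n) \<bullet> y)\<^sup>2)"
      unfolding w_def by (rule norm_orthonormal_sum[OF e]) simp
    also have "\<dots> = K w \<bullet> y"
      by (simp add: w_def sum scaleR inner_sum_left power2_eq_square)
    also have "\<dots> \<le> norm (K w) * norm y"
      by (rule norm_cauchy_schwarz)
    also have "\<dots> \<le> (onorm K * norm w) * norm y"
      by (intro mult_right_mono onorm[OF K]) simp
    finally have "norm w * norm w \<le> norm w * (onorm K * norm y)"
      by (simp add: power2_eq_square mult_ac)
    then have "norm w \<le> onorm K * norm y"
      using onorm_pos_le[OF K] by (cases "w = 0") auto
    then show "(\<Sum>n<N. (K (e n) \<bullet> y)\<^sup>2) \<le> (onorm K * norm y)\<^sup>2"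
      unfolding w[symmetric] by (intro power_mono) auto
  qed simp
  define K' where "K' y = (\<Sum>n. (K (e n) \<bullet> y) *\<^sub>R e n)" for y
  have "K x \<bullet> y = x \<bullet> K' y" for x y
  proof -
    have x: "(\<lambda>n. (x \<bullet> e n) *\<^sub>R e n) sums x"
      by (rule complete_orthonormal_sums[OF e])
    have "(\<lambda>n. K ((x \<bullet> e n) *\<^sub>R e n) \<bullet> y) sums (K x \<bullet> y)"
      by (intro bounded_linear.sums[OF bounded_linear_inner_left] sums x)
    moreover have "(\<lambda>n. ((x \<bullet> e n) *\<^sub>R e n) \<bullet> K' y) sums (x \<bullet> K' y)"
      by (intro bounded_linear.sums[OF bounded_linear_inner_left] x)
    moreover have "e n \<bullet> K' y = K (e n) \<bullet> y" for n
      using riesz_fischer(2)[OF e summ[of y]] by (simp add: K'_def inner_commute)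
    ultimately show ?thesis
      by (simp add: scaleR sums_unique2)
  qed
  then have "\<exists>f'. \<forall>x y. K x \<bullet> y = x \<bullet> f' y"
    by blast
  then have "\<forall>x y. K x \<bullet> y = x \<bullet> adjoint K y"
    unfolding adjoint_def by (rule someI_ex)
  then show ?thesis
    by simp
qed

section \<open>Soft thresholding in singular coordinates\<close>

lemma abs_soft_threshold_le: "\<alpha> > 0 \<Longrightarrow> \<bar>soft_threshold \<alpha> t\<bar> \<le> \<bar>t\<bar>"
  by (auto simp: soft_threshold_def)

lemma abs_soft_threshold_diff_le: "\<alpha> > 0 \<Longrightarrow> \<bar>soft_threshold \<alpha> t - t\<bar> \<le> \<bar>t\<bar>"
  by (auto simp: soft_threshold_def)

lemma singular_system_pos: "singular_system K \<sigma> v u \<Longrightarrow> \<sigma> n > 0"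
  unfolding singular_system_def singular_values_def
  by (metis (mono_tags, lifting) mem_Collect_eq rangeI)

lemma singular_system_le_onorm:
  assumes K: "bounded_linear K" and sys: "singular_system K \<sigma> v u"
  shows "\<sigma> n \<le> onorm K"
proof -
  have "norm (K (v n)) \<le> onorm K * norm (v n)"
    by (rule onorm[OF K])
  then show ?thesis
    using sys singular_system_pos[OF sys, of n] by (simp add: singular_system_def)
qed

lemma singular_system_range_coordinate:
  assumes K: "bounded_linear K" and sys: "singular_system K \<sigma> v u"
  shows "K x \<bullet> u n = \<sigma> n * (x \<bullet> v n)"
proof -
  have "complete_orthonormal v" and u: "adjoint K (u n) = \<sigma> n *\<^sub>R v n"
    using sys by (simp_all add: singular_system_def)
  then show ?thesis
    using adjoint_works_orthonormal[OF K, of v x "u n"] by (simp add: u)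
qed

lemma singular_system_adjoint_coordinate:
  assumes K: "bounded_linear K" and sys: "singular_system K \<sigma> v u"
  shows "adjoint K z \<bullet> v n = \<sigma> n * (z \<bullet> u n)"
proof -
  have "v n \<bullet> adjoint K z = K (v n) \<bullet> z"
    using adjoint_works_orthonormal[OF K, of v] sys by (simp add: singular_system_def)
  then show ?thesis
    using sys by (simp add: singular_system_def inner_commute)
qed

text \<open>
  For exact data the regularization error is coordinatewise no larger than the solution. This
  is where the convergence of the regularizing series enters: without it the infinite
  sum would have unknown coordinates.
\<close>

lemma soft_regularization_error_coordinate_le:
  assumes K: "bounded_linear K" and sys: "singular_system K \<sigma> v u" and "\<alpha> > 0"
  shows "\<bar>(soft_regularization \<sigma> v u \<alpha> (K x) - x) \<bullet> v n\<bar> \<le> \<bar>x \<bullet> v n\<bar>"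
proof -
  define c where "c n = 1 / (\<sigma> n)\<^sup>2 * soft_threshold \<alpha> (\<sigma> n * (K x \<bullet> u n))" for n
  have v: "complete_orthonormal v"
    using sys by (simp add: singular_system_def)
  have pos: "\<sigma> n > 0" for n
    by (rule singular_system_pos[OF sys])
  have arg: "\<sigma> n * (K x \<bullet> u n) = (\<sigma> n)\<^sup>2 * (x \<bullet> v n)" for n
    by (simp add: singular_system_range_coordinate[OF K sys] power2_eq_square)
  have "\<bar>c n\<bar> \<le> \<bar>x \<bullet> v n\<bar>" for n
    using abs_soft_threshold_le[OF \<open>\<alpha> > 0\<close>, of "(\<sigma> n)\<^sup>2 * (x \<bullet> v n)"] pos[of n]
    by (simp add: c_def arg abs_mult field_simps)
  then have "summable (\<lambda>n. (c n)\<^sup>2)"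
    by (intro summable_comparison_test'[OF sums_summable[OF parseval[OF v, of x]]])
      (simp add: abs_le_square_iff)
  then have "soft_regularization \<sigma> v u \<alpha> (K x) \<bullet> v n = c n"
    unfolding soft_regularization_def c_def by (rule riesz_fischer(2)[OF v])
  moreover have "c n - x \<bullet> v n
      = (soft_threshold \<alpha> ((\<sigma> n)\<^sup>2 * (x \<bullet> v n)) - (\<sigma> n)\<^sup>2 * (x \<bullet> v n)) / (\<sigma> n)\<^sup>2"
    using pos[of n] by (simp add: c_def arg field_simps)
  moreover have "\<bar>\<dots>\<bar> \<le> \<bar>x \<bullet> v n\<bar>"
    using abs_soft_threshold_diff_le[OF \<open>\<alpha> > 0\<close>, of "(\<sigma> n)\<^sup>2 * (x \<bullet> v n)"] pos[of n]
    by (simp add: abs_mult field_simps)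
  ultimately show ?thesis
    by (simp add: inner_diff_left)
qed

section \<open>Error estimates under source conditions\<close>

text \<open>
  The common form of both source conditions: the coordinates of \<open>x\<close> are those of a source
  element \<open>z\<close> in some complete orthonormal system, damped by factors that are at most \<open>C\<close>.
\<close>

lemma soft_regularization_error_le:
  assumes "bounded_linear K" "singular_system K \<sigma> v u" "\<alpha> > 0" "complete_orthonormal f"
    and coord: "\<And>n. x \<bullet> v n = s n * (z \<bullet> f n)" and s: "\<And>n. 0 < s n" "\<And>n. s n \<le> C"
  shows "norm (soft_regularization \<sigma> v u \<alpha> (K x) - x) \<le> C * norm z"
proof (rule norm_le_by_coordinates)
  show "complete_orthonormal v"
    using assms(2) by (simp add: singular_system_def)
  show "C \<ge> 0"
    using s[of 0] by linarith
  fix n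
  have "\<bar>(soft_regularization \<sigma> v u \<alpha> (K x) - x) \<bullet> v n\<bar> \<le> \<bar>x \<bullet> v n\<bar>"
    by (rule soft_regularization_error_coordinate_le[OF assms(1-3)])
  also have "\<dots> = s n * \<bar>z \<bullet> f n\<bar>"
    using s(1)[of n] by (simp add: coord abs_mult)
  also have "\<dots> \<le> C * \<bar>z \<bullet> f n\<bar>"
    by (intro mult_right_mono s) simp
  finally show "\<bar>(soft_regularization \<sigma> v u \<alpha> (K x) - x) \<bullet> v n\<bar> \<le> C * \<bar>z \<bullet> f n\<bar>" .
qed (rule assms(4))

theorem theorem3p8:
  fixes K :: "'a::{real_inner,complete_space} \<Rightarrow> 'b::{real_inner,complete_space}"
    and \<sigma> :: "nat \<Rightarrow> real" and v :: "nat \<Rightarrow> 'a" and u :: "nat \<Rightarrow> 'b"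
    and y\<delta> :: 'b and A :: "real set"
  assumes "compact_operator K"
    and "singular_system K \<sigma> v u"
    and "\<forall>\<alpha>>0. \<exists>c. \<forall>n. 0 < \<sigma> n \<and> \<sigma> n \<le> onorm K \<and> \<bar>\<sigma> n * (y\<delta> \<bullet> u n)\<bar> > \<alpha> / 2
            \<longrightarrow> c * \<sigma> n \<ge> 1"
    and "A \<subseteq> {0<..}"
  shows
    "(\<forall>c1. (\<forall>\<alpha>\<in>A. \<forall>n. 0 < \<sigma> n \<and> \<sigma> n \<le> onorm K \<longrightarrow>
              c1 \<ge> \<sigma> n / sqrt \<alpha> \<and> \<sigma> n / sqrt \<alpha> > 0) \<longrightarrow>
        (\<forall>\<alpha>\<in>A. \<forall>x\<in>range (adjoint K). \<forall>z. x = adjoint K z \<longrightarrow>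
           norm (soft_regularization \<sigma> v u \<alpha> (K x) - x) \<le> c1 * sqrt \<alpha> * norm z)) \<and>
     (\<forall>c2. (\<forall>\<alpha>\<in>A. \<forall>n. 0 < \<sigma> n \<and> \<sigma> n \<le> onorm K \<longrightarrow>
              c2 \<ge> (\<sigma> n)\<^sup>2 / \<alpha> \<and> (\<sigma> n)\<^sup>2 / \<alpha> > 0) \<longrightarrow>
        (\<forall>\<alpha>\<in>A. \<forall>x\<in>range (adjoint K \<circ> K). \<forall>z. x = adjoint K (K z) \<longrightarrow>
           norm (soft_regularization \<sigma> v u \<alpha> (K x) - x) \<le> c2 * \<alpha> * norm z))"
proof -
  have K: "bounded_linear K"
    by (rule compact_operator_bounded_linear[OF assms(1)])
  note sys = assms(2)
  have v: "complete_orthonormal v" and u: "complete_orthonormal u"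
    using sys by (simp_all add: singular_system_def)
  have pos: "0 < \<sigma> n" and le: "\<sigma> n \<le> onorm K" for n
    using singular_system_pos[OF sys] singular_system_le_onorm[OF K sys] by auto
  have "norm (soft_regularization \<sigma> v u \<alpha> (K (adjoint K z)) - adjoint K z)
      \<le> (c1 * sqrt \<alpha>) * norm z"
    if c1: "\<forall>\<alpha>\<in>A. \<forall>n. 0 < \<sigma> n \<and> \<sigma> n \<le> onorm K \<longrightarrow>
              c1 \<ge> \<sigma> n / sqrt \<alpha> \<and> \<sigma> n / sqrt \<alpha> > 0"
      and "\<alpha> \<in> A" for c1 \<alpha> z
  proof (rule soft_regularization_error_le[OF K sys _ u, where s = \<sigma>])
    show \<alpha>: "\<alpha> > 0"
      using assms(4) \<open>\<alpha> \<in> A\<close> by auto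
    show "\<sigma> n \<le> c1 * sqrt \<alpha>" for n
    proof -
      have "\<sigma> n / sqrt \<alpha> \<le> c1"
        using c1 \<open>\<alpha> \<in> A\<close> pos le by blast
      then show ?thesis
        using \<alpha> by (simp add: pos_divide_le_eq)
    qed
    show "adjoint K z \<bullet> v n = \<sigma> n * (z \<bullet> u n)" for n
      by (rule singular_system_adjoint_coordinate[OF K sys])
  qed (rule pos)
  moreover have "norm (soft_regularization \<sigma> v u \<alpha> (K (adjoint K (K z))) - adjoint K (K z))
      \<le> (c2 * \<alpha>) * norm z"
    if c2: "\<forall>\<alpha>\<in>A. \<forall>n. 0 < \<sigma> n \<and> \<sigma> n \<le> onorm K \<longrightarrow>
              c2 \<ge> (\<sigma> n)\<^sup>2 / \<alpha> \<and> (\<sigma> n)\<^sup>2 / \<alpha> > 0"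
      and "\<alpha> \<in> A" for c2 \<alpha> z
  proof (rule soft_regularization_error_le[OF K sys _ v, where s = "\<lambda>n. (\<sigma> n)\<^sup>2"])
    show \<alpha>: "\<alpha> > 0"
      using assms(4) \<open>\<alpha> \<in> A\<close> by auto
    show "(\<sigma> n)\<^sup>2 \<le> c2 * \<alpha>" for n
    proof -
      have "(\<sigma> n)\<^sup>2 / \<alpha> \<le> c2"
        using c2 \<open>\<alpha> \<in> A\<close> pos le by blast
      then show ?thesis
        using \<alpha> by (simp add: pos_divide_le_eq)
    qed
    show "adjoint K (K z) \<bullet> v n = (\<sigma> n)\<^sup>2 * (z \<bullet> v n)" for n
      by (simp add: singular_system_adjoint_coordinate[OF K sys]
          singular_system_range_coordinate[OF K sys] power2_eq_square)
  qed (simp add: pos less_imp_neq[THEN not_sym])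
  ultimately show ?thesis
    by blast
qed

end
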